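(* Let $A$ be a finite set of atoms and let $P=\{r_1,\ldots,r_n\}$, $n\ge2$, be an acyclic propositional Horn theory over $A$ with level mapping $\ell$, where the rules are listed in a linear order $r_1<_\ell\cdots<_\ell r_n$ obtained from $\ell$ (so $\ell(head(r_i))\le\ell(head(r_j))$ whenever $i<j$, with ties broken by an arbitrarily chosen linear order within each level). Then $$P=\prod_{i=1}^n cl_{bh_i(P)}(\{r_i\})=cl_{bh_1(P)}(\{r_1\})\circ cl_{bh_2(P)}(\{r_2\})\circ\cdots\circ cl_{bh_n(P)}(\{r_n\}),$$ where $bh_i(P)=body(\{r_1,\ldots,r_{i-1}\})\cup head(\{r_{i+1},\ldots,r_n\})$. This decomposition is unique up to reordering of rules within a single level.
   Context: A theory over $A$ is a finite set of rules $a_0\leftarrow a_1,\ldots,a_k$ ($k\ge0$, $a_i\in A$), with $head(r)=\{a_0\}$, $body(r)=\{a_1,\ldots,a_k\}$, size $k$; for a set $S$ of rules $head(S),body(S)$ are the unions of heads and bodies. Write $S\subseteq_r R$ if $S\subseteq R$ has as many elements as the size of $r$. Composition: $P\circ R=\{head(r)\leftarrow body(S)\mid r\in P,\ S\subseteq_r R,\ head(S)=body(r)\}$ (it is associative). For $B\subseteq A$, $1_B=\{a\leftarrow a\mid a\in B\}$ and the closure is $cl_B(P)=1_B\cup P$. A theory $P$ is acyclic if there is a map $\ell:A\to\{0,1,2,\ldots\}$ (a level mapping) such that for each rule $r\in P$, the level of the head atom of $r$ is strictly greater than the level of every body atom of $r$. *)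

theory Defs
  imports Main "HOL-Combinatorics.Permutations"
begin

text \<open>
  A rule is identified with its head atom and its set of body atoms, so that its size is the
  cardinality of the body.
\<close>

datatype 'a rule = Rule (head_atom: 'a) (body: "'a set")

definition heads :: "'a rule set \<Rightarrow> 'a set" where
  "heads S = (\<Union>r\<in>S. {head_atom r})"

definition bodies :: "'a rule set \<Rightarrow> 'a set" where
  "bodies S = (\<Union>r\<in>S. body r)"

definition horn_theory :: "'a set \<Rightarrow> 'a rule set \<Rightarrow> bool" where
  "horn_theory A P \<longleftrightarrow>
     finite P \<and> (\<forall>r\<in>P. head_atom r \<in> A \<and> body r \<subseteq> A \<and> finite (body r))"

definition rule_subset :: "'a rule set \<Rightarrow> 'a rule \<Rightarrow> 'a rule set \<Rightarrow> bool" where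
  "rule_subset S r R \<longleftrightarrow> S \<subseteq> R \<and> finite S \<and> card S = card (body r)"

definition horn_comp :: "'a rule set \<Rightarrow> 'a rule set \<Rightarrow> 'a rule set" (infixl "\<circ>\<^sub>H" 70) where
  "P \<circ>\<^sub>H R = {Rule (head_atom r) (bodies S) | r S.
               r \<in> P \<and> rule_subset S r R \<and> heads S = body r}"

definition unit_theory :: "'a set \<Rightarrow> 'a rule set" where
  "unit_theory B = (\<lambda>a. Rule a {a}) ` B"

definition closure_theory :: "'a set \<Rightarrow> 'a rule set \<Rightarrow> 'a rule set" where
  "closure_theory B P = unit_theory B \<union> P"

definition level_mapping :: "('a \<Rightarrow> nat) \<Rightarrow> 'a rule set \<Rightarrow> bool" where
  "level_mapping l P \<longleftrightarrow> (\<forall>r\<in>P. \<forall>b\<in>body r. l b < l (head_atom r))"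

text \<open>
  A theory is acyclic if it has a level mapping in the above sense.  The listings below are those
  without repetition, in an order obtained from the level mapping.  Rules whose heads are on the
  same level may occur in any order relative to each other.
\<close>

definition level_listing :: "('a \<Rightarrow> nat) \<Rightarrow> 'a rule set \<Rightarrow> 'a rule list \<Rightarrow> bool" where
  "level_listing l P rs \<longleftrightarrow>
     set rs = P \<and> distinct rs \<and>
     (\<forall>i j. i < j \<and> j < length rs \<longrightarrow> l (head_atom (rs ! i)) \<le> l (head_atom (rs ! j)))"

text \<open>Positions in the list are counted from 0.\<close>

definition bh :: "'a rule list \<Rightarrow> nat \<Rightarrow> 'a set" where
  "bh rs i = bodies (set (take i rs)) \<union> heads (set (drop (Suc i) rs))"

definition factors :: "'a rule list \<Rightarrow> 'a rule set list" where
  "factors rs = map (\<lambda>i. closure_theory (bh rs i) {rs ! i}) [0..<length rs]"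

text \<open>The left-nested product of a nonempty list; the empty list is never used.\<close>

definition horn_prod :: "'a rule set list \<Rightarrow> 'a rule set" where
  "horn_prod Fs = foldl (\<circ>\<^sub>H) (hd Fs) (tl Fs)"

text \<open>
  An unbracketed product presupposes that the bracketing is irrelevant.  Composition of theories
  is not associative in general: with P = {a <- b,c}, Q = {b <- d, c <- d} and
  R = {d <- e, d <- f}, the rule a <- e,f belongs to P (Q R) but not to (P Q) R.  Hence the
  following relation between a list of theories and the values of all its bracketings.
\<close>

inductive bracketing_value :: "'a rule set list \<Rightarrow> 'a rule set \<Rightarrow> bool" where
  single: "bracketing_value [X] X"
| comp: "bracketing_value Xs X \<Longrightarrow> bracketing_value Ys Y \<Longrightarrow> bracketing_value (Xs @ Ys) (X \<circ>\<^sub>H Y)"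

text \<open>
  The decompositions of a theory P of the form under consideration.  Each is given by its sequence
  of rules, which has to be the listing, in an order obtained from the given level mapping, of
  some theory that is acyclic with respect to that mapping.  It is not presupposed that this
  theory is P.
\<close>

definition level_decomposition ::
    "'a set \<Rightarrow> ('a \<Rightarrow> nat) \<Rightarrow> 'a rule set \<Rightarrow> 'a rule list \<Rightarrow> bool" where
  "level_decomposition A l P ss \<longleftrightarrow>
     ss \<noteq> [] \<and>
     (\<exists>Q. horn_theory A Q \<and> level_mapping l Q \<and> level_listing l Q ss) \<and>
     P = horn_prod (factors ss)"

definition reordering_within_levels ::
    "('a \<Rightarrow> nat) \<Rightarrow> 'a rule list \<Rightarrow> 'a rule list \<Rightarrow> bool" where
  "reordering_within_levels l rs ss \<longleftrightarrow>
     (\<exists>\<pi>. \<pi> permutes {..<length rs} \<and>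
          (\<forall>i<length rs. l (head_atom (rs ! \<pi> i)) = l (head_atom (rs ! i))) \<and>
          ss = permute_list \<pi> rs)"

end

(* Every bracketing of a contiguous block r_i, ..., r_j of factors evaluates to
   cl_B({r_i, ..., r_j}), where B consists of the body atoms of the rules before the block and
   the head atoms of the rules after it. This survives composing adjacent blocks because, by the
   level mapping, no head of a rule is a body atom of the same or an earlier rule: the rules of
   the left block can only be composed with unit rules, and the unit rules of the left block
   select exactly the rules of the right block together with the unit rules of the union.
   For the whole list B is empty. Hence a level decomposition of P is a level listing of P, and
   two level listings have the same sorted sequence of levels. *)

theory Submission
  imports Defs
begin

lemma heads_eq_image [simp]: "heads S = head_atom ` S"
  by (auto simp: heads_def)

lemma bodies_Un: "bodies (S \<union> T) = bodies S \<union> bodies T"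
  by (simp add: bodies_def)

lemma horn_comp_Un_left: "(P \<union> Q) \<circ>\<^sub>H R = (P \<circ>\<^sub>H R) \<union> (Q \<circ>\<^sub>H R)"
  by (auto simp: horn_comp_def)

lemma heads_unit_theory: "heads (unit_theory B) = B"
  by (force simp: unit_theory_def)

lemma bodies_unit_theory: "bodies (unit_theory B) = B"
  by (auto simp: unit_theory_def bodies_def)

lemma bodies_eq_heads_if_subset_unit_theory:
  assumes "S \<subseteq> unit_theory B"
  shows "bodies S = heads S"
  using assms by (force simp: unit_theory_def bodies_def)

lemma card_unit_theory: "card (unit_theory B) = card B"
  by (simp add: unit_theory_def card_image inj_on_def)

text \<open>A unit rule has a body of size one, so the selected \<open>S\<close> is a singleton
  \<open>{t}\<close>, and the composite rule is \<open>t\<close> itself.\<close>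

lemma unit_theory_comp: "unit_theory B \<circ>\<^sub>H R = {s \<in> R. head_atom s \<in> B}"
proof (intro set_eqI iffI)
  fix s assume "s \<in> unit_theory B \<circ>\<^sub>H R"
  then obtain a S where a: "a \<in> B" "S \<subseteq> R" "card S = 1" "head_atom ` S = {a}"
    and s: "s = Rule a (bodies S)"
    by (auto simp: horn_comp_def unit_theory_def rule_subset_def)
  then obtain t where t: "S = {t}" by (auto simp: card_1_singleton_iff)
  with a s have "s = t" by (cases t) (simp add: bodies_def)
  with a t show "s \<in> {s \<in> R. head_atom s \<in> B}" by auto
next
  fix s assume "s \<in> {s \<in> R. head_atom s \<in> B}"
  then have "Rule (head_atom s) {head_atom s} \<in> unit_theory B"
    and "rule_subset {s} (Rule (head_atom s) {head_atom s}) R"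
    by (auto simp: unit_theory_def rule_subset_def)
  moreover have "s = Rule (head_atom (Rule (head_atom s) {head_atom s})) (bodies {s})"
    by (simp add: bodies_def)
  moreover have "heads {s} = body (Rule (head_atom s) {head_atom s})" by simp
  ultimately show "s \<in> unit_theory B \<circ>\<^sub>H R"
    unfolding horn_comp_def by blast
qed

text \<open>A selected rule from \<open>N\<close> would put its head into the body of a rule of
  \<open>M\<close>. So only unit rules are selected, and these reproduce the body.\<close>

lemma comp_closure_theory:
  assumes "\<forall>r\<in>M. finite (body r)" "bodies M \<subseteq> B" "heads N \<inter> bodies M = {}"
  shows "M \<circ>\<^sub>H closure_theory B N = M"
proof (intro set_eqI iffI)
  fix s assume "s \<in> M \<circ>\<^sub>H closure_theory B N"
  then obtain r S where r: "r \<in> M" "S \<subseteq> closure_theory B N" "heads S = body r"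
    and s: "s = Rule (head_atom r) (bodies S)"
    by (auto simp: horn_comp_def rule_subset_def)
  have "body r \<subseteq> bodies M" using r by (auto simp: bodies_def)
  with r assms(3) have "S \<inter> N = {}" by force
  with r have "S \<subseteq> unit_theory B" by (auto simp: closure_theory_def)
  then have "bodies S = body r" using bodies_eq_heads_if_subset_unit_theory r by blast
  with r s show "s \<in> M" by simp
next
  fix r assume r: "r \<in> M"
  \<comment> \<open>One unit rule per body atom: this has the cardinality that
    \<open>rule_subset\<close> demands, and both its heads and its bodies form
    \<open>body r\<close>.\<close>
  let ?S = "unit_theory (body r)"
  have "body r \<subseteq> B" using r assms(2) by (auto simp: bodies_def)
  then have "?S \<subseteq> closure_theory B N" by (auto simp: unit_theory_def closure_theory_def)
  moreover have "finite ?S" using r assms(1) by (simp add: unit_theory_def)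
  ultimately have "rule_subset ?S r (closure_theory B N)"
    by (simp add: rule_subset_def card_unit_theory)
  moreover have "r = Rule (head_atom r) (bodies ?S)" by (simp add: bodies_unit_theory)
  ultimately show "r \<in> M \<circ>\<^sub>H closure_theory B N"
    using r heads_unit_theory[of "body r"] unfolding horn_comp_def by blast
qed

text \<open>\<open>M\<close> and \<open>N\<close> play the two adjacent blocks, \<open>U\<close> the
  rules before them and \<open>V\<close> those after.\<close>

lemma comp_adjacent_closures:
  assumes "\<forall>r\<in>M. finite (body r)" "heads (N \<union> V) \<inter> bodies (U \<union> M) = {}"
  shows "closure_theory (bodies U \<union> heads (N \<union> V)) M \<circ>\<^sub>H closure_theory (bodies (U \<union> M) \<union> heads V) N
    = closure_theory (bodies U \<union> heads V) (M \<union> N)"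
proof -
  have M: "M \<circ>\<^sub>H closure_theory (bodies (U \<union> M) \<union> heads V) N = M"
    using assms by (intro comp_closure_theory) (auto simp: bodies_Un)
  \<comment> \<open>All of \<open>N\<close> passes the filter. A unit rule for an atom of
    \<open>bodies M\<close> passes only if the atom already lies in
    \<open>bodies U \<union> heads V\<close>, since \<open>heads N\<close> and
    \<open>bodies M\<close> are disjoint.\<close>
  have "{s \<in> closure_theory (bodies (U \<union> M) \<union> heads V) N. head_atom s \<in> bodies U \<union> heads (N \<union> V)}
      = unit_theory (bodies U \<union> heads V) \<union> N"
    using assms(2) by (auto simp: closure_theory_def unit_theory_def bodies_Un)
  with M show ?thesis
    unfolding closure_theory_def[of _ M] horn_comp_Un_left unit_theory_comp
    by (auto simp: closure_theory_def)
qed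

text \<open>Half-open index ranges let adjacent blocks share the endpoint, and images under
  \<open>(!) rs\<close> turn unions of ranges into unions of rule sets. Blocks of length one are the
  factors.\<close>

definition block :: "'a rule list \<Rightarrow> nat \<Rightarrow> nat \<Rightarrow> 'a rule set" where
  "block rs i j = closure_theory
     (bodies ((!) rs ` {..<i}) \<union> heads ((!) rs ` {j..<length rs})) ((!) rs ` {i..<j})"

lemma set_drop_nth_image: "set (drop k xs) = (!) xs ` {k..<length xs}"
proof -
  have "drop k xs = map ((!) xs) [k..<length xs]"
    by (rule nth_equalityI) auto
  then show ?thesis by simp
qed

lemma factors_eq_map_block: "factors rs = map (\<lambda>i. block rs i (Suc i)) [0..<length rs]"
  unfolding factors_def block_def bh_def
  by (intro map_cong)
     (auto simp: set_drop_nth_image nth_image[symmetric] atLeast0LessThan)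

lemma level_listing_head_notin_body:
  assumes "level_mapping l P" "level_listing l P rs" "i \<le> j" "j < length rs"
  shows "head_atom (rs ! j) \<notin> body (rs ! i)"
proof
  assume "head_atom (rs ! j) \<in> body (rs ! i)"
  moreover have "rs ! i \<in> P" using assms by (auto simp: level_listing_def)
  ultimately have "l (head_atom (rs ! j)) < l (head_atom (rs ! i))"
    using assms(1) by (auto simp: level_mapping_def)
  \<comment> \<open>The listing compares only distinct positions, so \<open>i = j\<close> is treated
    separately.\<close>
  moreover have "l (head_atom (rs ! i)) \<le> l (head_atom (rs ! j))"
    using assms by (cases "i = j") (auto simp: level_listing_def)
  ultimately show False by simp
qed

lemma block_comp_block:
  assumes "horn_theory A P" "level_mapping l P" "level_listing l P rs"
    and "i \<le> k" "k \<le> j" "j \<le> length rs"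
  shows "block rs i k \<circ>\<^sub>H block rs k j = block rs i j"
proof -
  define U M N V where "U = (!) rs ` {..<i}" and "M = (!) rs ` {i..<k}"
    and "N = (!) rs ` {k..<j}" and "V = (!) rs ` {j..<length rs}"
  have UM: "U \<union> M = (!) rs ` {..<k}" and MN: "M \<union> N = (!) rs ` {i..<j}"
    and NV: "N \<union> V = (!) rs ` {k..<length rs}"
    using assms(4-6) by (auto simp: U_def M_def N_def V_def image_Un[symmetric] ivl_disj_un)
  have "M \<subseteq> P" using assms(3-6) by (auto simp: M_def level_listing_def)
  then have "\<forall>r\<in>M. finite (body r)" using assms(1) by (auto simp: horn_theory_def)
  \<comment> \<open>\<open>U\<close> and \<open>M\<close> fill the positions below \<open>k\<close>,
    \<open>N\<close> and \<open>V\<close> those from \<open>k\<close> on.\<close>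
  moreover have "heads (N \<union> V) \<inter> bodies (U \<union> M) = {}"
    using level_listing_head_notin_body[OF assms(2,3)]
    by (fastforce simp: UM NV bodies_def)
  ultimately show ?thesis
    using comp_adjacent_closures[of M N V U] by (simp only: block_def UM MN NV flip: U_def M_def N_def V_def)
qed

lemma bracketing_value_not_Nil: "bracketing_value Fs X \<Longrightarrow> Fs \<noteq> []"
  by (induction rule: bracketing_value.induct) auto

text \<open>Arbitrary ranges are needed because the outermost composition may split the list
  anywhere.\<close>

lemma bracketing_value_blocks:
  assumes "horn_theory A P" "level_mapping l P" "level_listing l P rs"
    and "bracketing_value Fs X"
    and "Fs = map (\<lambda>i. block rs i (Suc i)) [i..<j]" "j \<le> length rs"
  shows "X = block rs i j"
  using assms(4-)
proof (induction arbitrary: i j rule: bracketing_value.induct)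
  case (single X)
  then have "length [i..<j] = 1" by (metis length_map length_Cons list.size(3) One_nat_def)
  then have "j = Suc i" by simp
  with single show ?case by simp
next
  case (comp Xs X Ys Y)
  obtain k where k: "k = i + length Xs" by simp
  have "length (Xs @ Ys) = j - i" using comp.prems by simp
  \<comment> \<open>Subtraction is truncated: only a nonempty list excludes \<open>j < i\<close>,
    which \<open>k \<le> j\<close> requires.\<close>
  moreover have "length Ys \<noteq> 0" using comp.hyps(2) bracketing_value_not_Nil by simp
  ultimately have ikj: "i \<le> k" "k \<le> j" using k unfolding length_append by linarith+
  then have "[i..<j] = [i..<k] @ [k..<j]" by (metis le_Suc_ex upt_add_eq_append)
  with comp.prems(1) have "Xs @ Ys = map (\<lambda>i. block rs i (Suc i)) [i..<k]
      @ map (\<lambda>i. block rs i (Suc i)) [k..<j]"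
    by (simp only: map_append)
  moreover have "length Xs = length (map (\<lambda>i. block rs i (Suc i)) [i..<k])"
    using k by simp
  ultimately have "Xs = map (\<lambda>i. block rs i (Suc i)) [i..<k]"
    "Ys = map (\<lambda>i. block rs i (Suc i)) [k..<j]"
    by (metis append_eq_append_conv)+
  with comp.IH comp.prems ikj have "X = block rs i k" "Y = block rs k j" by auto
  then show ?case using block_comp_block[OF assms(1-3)] ikj comp.prems by simp
qed

text \<open>The induction peels off the last factor, as the outermost composition of
  \<open>foldl\<close> is the last one.\<close>

lemma bracketing_value_horn_prod:
  assumes "Fs \<noteq> []"
  shows "bracketing_value Fs (horn_prod Fs)"
proof -
  have "bracketing_value (X # Xs) (foldl (\<circ>\<^sub>H) X Xs)" for X :: "'a rule set" and Xs
  proof (induction Xs rule: rev_induct)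
    case (snoc Y Ys)
    then show ?case using bracketing_value.comp[OF snoc bracketing_value.single[of Y]] by simp
  qed (simp add: bracketing_value.single)
  from this[of "hd Fs" "tl Fs"] assms show ?thesis by (simp add: horn_prod_def)
qed

lemma bracketing_value_factors:
  assumes "horn_theory A P" "level_mapping l P" "level_listing l P rs"
    and "bracketing_value (factors rs) X"
  shows "X = P"
proof -
  have "X = block rs 0 (length rs)"
    using bracketing_value_blocks[OF assms factors_eq_map_block] by simp
  also have "\<dots> = set rs"
    by (auto simp: block_def closure_theory_def unit_theory_def bodies_def in_set_conv_nth)
  finally show ?thesis using assms(3) by (simp add: level_listing_def)
qed

lemma horn_prod_factors:
  assumes "horn_theory A P" "level_mapping l P" "level_listing l P rs" "rs \<noteq> []"
  shows "horn_prod (factors rs) = P"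
  using bracketing_value_factors[OF assms(1-3)] bracketing_value_horn_prod[of "factors rs"] assms(4)
  by (simp add: factors_def)

text \<open>The theory \<open>Q\<close> hidden in a decomposition equals the product of its factors,
  hence \<open>Q = P\<close>.\<close>

lemma level_decomposition_iff_level_listing:
  assumes "horn_theory A P" "level_mapping l P"
  shows "level_decomposition A l P ss \<longleftrightarrow> ss \<noteq> [] \<and> level_listing l P ss"
  using assms horn_prod_factors unfolding level_decomposition_def by metis

lemma level_listing_iff_sorted:
  "level_listing l P rs \<longleftrightarrow>
     set rs = P \<and> distinct rs \<and> sorted (map (\<lambda>r. l (head_atom r)) rs)"
  by (auto simp: level_listing_def sorted_iff_nth_mono_less)

lemma level_listing_iff_reordering:
  assumes "level_listing l P rs"
  shows "level_listing l P ss \<longleftrightarrow> reordering_within_levels l rs ss"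
proof
  let ?lev = "\<lambda>r. l (head_atom r)"
  assume ss: "level_listing l P ss"
  with assms have mset: "mset ss = mset rs"
    by (simp add: level_listing_iff_sorted flip: set_eq_iff_mset_eq_distinct)
  then obtain \<pi> where \<pi>: "\<pi> permutes {..<length rs}" "permute_list \<pi> rs = ss"
    by (rule mset_eq_permutation)
  have "mset (map ?lev ss) = mset (map ?lev rs)" using mset by simp
  \<comment> \<open>Two sorted lists with the same multiset coincide, so the permutation preserves
    the level at every position.\<close>
  with ss assms have "map ?lev ss = map ?lev rs"
    by (metis level_listing_iff_sorted properties_for_sort sorted_sort_id)
  then have "?lev (ss ! i) = ?lev (rs ! i)" if "i < length rs" for i
    using that by (metis length_map nth_map)
  with \<pi> show "reordering_within_levels l rs ss"
    unfolding reordering_within_levels_def by (metis permute_list_nth)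
next
  assume "reordering_within_levels l rs ss"
  then obtain \<pi> where \<pi>: "\<pi> permutes {..<length rs}" "ss = permute_list \<pi> rs"
    and lev: "\<forall>i<length rs. l (head_atom (rs ! \<pi> i)) = l (head_atom (rs ! i))"
    unfolding reordering_within_levels_def by blast
  have "map (\<lambda>r. l (head_atom r)) ss = map (\<lambda>r. l (head_atom r)) rs"
    using \<pi> lev by (intro nth_equalityI) (auto simp: permute_list_nth)
  with \<pi> assms show "level_listing l P ss" by (simp add: level_listing_iff_sorted)
qed

theorem theorem5p6:
  fixes A :: "'a set" and P :: "'a rule set" and l :: "'a \<Rightarrow> nat" and rs :: "'a rule list"
  assumes "finite A"
    and "horn_theory A P"
    and "level_mapping l P"
    and "level_listing l P rs"
    and "length rs \<ge> 2"
  shows "P = horn_prod (factors rs)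
    \<and> (\<forall>X. bracketing_value (factors rs) X \<longrightarrow> X = P)
    \<and> (\<forall>ss. level_decomposition A l P ss \<longleftrightarrow> reordering_within_levels l rs ss)"
proof -
  have "rs \<noteq> []" using assms(5) by auto
  \<comment> \<open>Decompositions are nonempty by definition; for listings of \<open>P\<close> this
    follows from \<open>P\<close> being nonempty.\<close>
  moreover have "ss \<noteq> []" if "level_listing l P ss" for ss
    using that assms(4) \<open>rs \<noteq> []\<close> by (auto simp: level_listing_def)
  ultimately show ?thesis
    using horn_prod_factors[OF assms(2-4)] bracketing_value_factors[OF assms(2-4)]
      level_decomposition_iff_level_listing[OF assms(2,3)] level_listing_iff_reordering[OF assms(4)]
    by metis
qed

end
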